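(* Let $1\le p<n$. The subequation $$\mathcal P_p^{\rm largest}=\Bigl\{A\in\mathrm{Sym}^2(\mathbb R^n):\ A+\tfrac{p-1}{n-p}(\mathrm{tr}\,A)\,I\ge0\Bigr\}$$ contains all the $O(n)$-invariant convex cone subequations $F\subset\mathrm{Sym}^2(\mathbb R^n)$ of Riesz characteristic $p$, and has Riesz characteristic $p$ itself. Since $\mathcal P_p^{\rm largest}=\mathcal P(\delta)$ with $\delta=\frac{(p-1)n}{n-p}$, the subequation $\mathcal P_p^{\rm largest}$ is uniformly elliptic when $p>1$.
   Context: Fix $n\ge 2$. $\mathrm{Sym}^2(\mathbb R^n)$ is the space of real symmetric $n\times n$ matrices and $\mathcal P=\{A: A\ge 0\}$. A subequation is a nonempty proper closed subset $F\subset \mathrm{Sym}^2(\mathbb R^n)$ with $F+\mathcal P\subset F$. It is a cone if $tF\subset F$ for all $t\ge 0$, and $O(n)$-invariant if invariant under $A\mapsto gAg^t$ for all $g\in O(n)$. For a unit vector $e$, $P_e$ and $P_{e^\perp}=I-P_e$ are the orthogonal projections onto $\mathbb R e$ and $e^\perp$. The Riesz characteristic of an $O(n)$-invariant cone subequation is $p_F=\sup\{\bar p: P_{e^\perp}-(\bar p-1)P_e\in F\}$ (independent of $e$). For $\delta\ge0$, $\mathcal P(\delta)=\{A: A+\frac{\delta}{n}(\mathrm{tr}\,A)I\ge0\}$. A subequation $F$ is uniformly elliptic if $F+\mathcal P(\delta)\subset F$ for some $\delta>0$. *)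

theory Defs
  imports "HOL-Analysis.Analysis"
begin

definition Sym2 :: "(real^'n^'n) set"
  where "Sym2 = {A. transpose A = A}"

definition pos_semidef :: "real^'n^'n \<Rightarrow> bool"
  where "pos_semidef A \<longleftrightarrow> A \<in> Sym2 \<and> (\<forall>x. 0 \<le> x \<bullet> (A *v x))"

definition PSD :: "(real^'n^'n) set"
  where "PSD = {A. pos_semidef A}"

text \<open>The sum of two sets is the Minkowski sum. Since \<^const>\<open>Sym2\<close> is a closed subspace, being
  closed in \<^const>\<open>Sym2\<close> is the same as being closed in the space of all matrices.\<close>

definition subequation :: "(real^'n^'n) set \<Rightarrow> bool"
  where "subequation F \<longleftrightarrow> F \<noteq> {} \<and> F \<subset> Sym2 \<and> closed F \<and> F + PSD \<subseteq> F"

definition orthogonally_invariant :: "(real^'n^'n) set \<Rightarrow> bool"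
  where "orthogonally_invariant F \<longleftrightarrow>
    (\<forall>g A. orthogonal_matrix g \<longrightarrow> A \<in> F \<longrightarrow> g ** A ** transpose g \<in> F)"

text \<open>The following is the orthogonal projection onto the line through \<open>e\<close> only if \<open>e\<close> is a unit vector.\<close>

definition line_proj :: "real^'n \<Rightarrow> real^'n^'n"
  where "line_proj e = matrix (\<lambda>x. (e \<bullet> x) *\<^sub>R e)"

definition perp_proj :: "real^'n \<Rightarrow> real^'n^'n"
  where "perp_proj e = mat 1 - line_proj e"

text \<open>The supremum is taken in the extended reals, since the set need not be bounded above for a
  general cone subequation. It ranges over all unit vectors; for an orthogonally invariant set each
  single unit vector gives the same value, see \<open>riesz_characteristic_eq\<close> below.\<close>

definition riesz_characteristic :: "(real^'n^'n) set \<Rightarrow> ereal"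
  where "riesz_characteristic F =
    Sup {ereal p | p. \<exists>e. norm e = 1 \<and> perp_proj e - (p - 1) *\<^sub>R line_proj e \<in> F}"

definition PSD_delta :: "real \<Rightarrow> (real^'n^'n) set"
  where "PSD_delta \<delta> =
    {A \<in> Sym2. pos_semidef (A + (\<delta> / real CARD('n) * trace A) *\<^sub>R mat 1)}"

definition uniformly_elliptic :: "(real^'n^'n) set \<Rightarrow> bool"
  where "uniformly_elliptic F \<longleftrightarrow> subequation F \<and> (\<exists>\<delta>>0. F + PSD_delta \<delta> \<subseteq> F)"

definition P_largest :: "real \<Rightarrow> (real^'n^'n) set"
  where "P_largest p =
    {A \<in> Sym2. pos_semidef (A + ((p - 1) / (real CARD('n) - p) * trace A) *\<^sub>R mat 1)}"

lemma line_proj_mult_vec: "line_proj e *v x = (e \<bullet> x) *\<^sub>R e"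
  by (simp add: line_proj_def matrix_works linear_matrix_vector_mul_eq
      linear_iff inner_add_right scaleR_left_distrib)

lemma line_proj_conj:
  fixes g :: "real^'n^'n"
  shows "g ** line_proj e ** transpose g = line_proj (g *v e)"
proof -
  have "(g ** line_proj e ** transpose g) *v x = line_proj (g *v e) *v x" for x
    by (simp add: line_proj_mult_vec matrix_vector_mult_scaleR dot_lmul_matrix [symmetric]
        inner_commute flip: matrix_vector_mul_assoc)
  then show ?thesis
    by (simp add: matrix_eq)
qed

lemma riesz_characteristic_eq:
  fixes F :: "(real^'n^'n) set"
  assumes inv: "orthogonally_invariant F" and e: "norm e = 1"
  shows "riesz_characteristic F = Sup {ereal p | p. perp_proj e - (p - 1) *\<^sub>R line_proj e \<in> F}"
proof -
  have "perp_proj e - (p - 1) *\<^sub>R line_proj e \<in> F"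
    if d: "norm d = 1" and F: "perp_proj d - (p - 1) *\<^sub>R line_proj d \<in> F" for d p
  proof -
    obtain f where f: "orthogonal_transformation f" "f d = e"
      using orthogonal_transformation_exists [of d e] d e by auto
    define g where "g = matrix f"
    have g: "orthogonal_matrix g" and gd: "g *v d = e"
      using f by (auto simp: g_def orthogonal_transformation_matrix matrix_works)
    have *: "perp_proj a - (p - 1) *\<^sub>R line_proj a = mat 1 - p *\<^sub>R line_proj a" for a :: "real^'n"
      by (simp add: perp_proj_def algebra_simps)
    have "g ** (mat 1 - p *\<^sub>R line_proj d) ** transpose g
        = g ** transpose g - p *\<^sub>R (g ** line_proj d ** transpose g)"
      unfolding matrix_eq
      by (simp add: matrix_vector_mult_diff_rdistrib matrix_vector_mult_diff_distrib
          matrix_vector_mult_scaleR flip: matrix_vector_mul_assoc scaleR_matrix_vector_assoc)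
    then show ?thesis
      using inv F g gd unfolding orthogonally_invariant_def *
      by (metis line_proj_conj orthogonal_matrix_def)
  qed
  then show ?thesis
    unfolding riesz_characteristic_def using e by (metis (no_types, lifting))
qed

end

theory Submission
  imports Defs
begin

text \<open>
  Write \<open>c = (p - 1) / (n - p)\<close>. The set \<open>P_largest p\<close> is \<open>PSD_delta (c n)\<close>, so its structural
  properties are those of the family \<open>PSD_delta\<close>: each member is a closed convex cone cut out by
  the orthogonally invariant inequalities \<open>x \<bullet> A x + c tr A (x \<bullet> x) \<ge> 0\<close>. Closure under addition
  is already uniform ellipticity, with the cone itself in the role of \<open>PSD_delta \<delta>\<close>. On
  \<open>P_e\<^sup>\<bottom> - (q - 1) P_e\<close> with \<open>q \<ge> 0\<close> the inequality is tightest in direction \<open>e\<close>, where it reads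
  \<open>(n - 1) (p - q) / (n - p) \<ge> 0\<close>; this gives the Riesz characteristic.

  The substance is maximality. Let \<open>F\<close> be an invariant convex cone subequation of characteristic
  \<open>p\<close>, let \<open>A \<in> F\<close>, and let \<open>e\<close> be a unit vector. Averaging \<open>A\<close> over the orthogonal maps that fix
  \<open>e\<close> stays in \<open>F\<close> and changes neither \<open>l = e \<bullet> A e\<close> nor the trace, so \<open>F\<close> contains some
  \<open>l P_e + m P_e\<^sup>\<bottom>\<close> with \<open>tr A = l + (n - 1) m\<close> (\<open>exists_axially_symmetric_mem\<close>). In these terms
  the inequality for \<open>A\<close> in direction \<open>e\<close> is equivalent to \<open>l + (p - 1) m \<ge> 0\<close>. If \<open>m > 0\<close>, dividing
  by \<open>m\<close> produces a competitor for the Riesz characteristic, and the bound by \<open>p\<close> is exactly this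
  inequality. If \<open>m \<le> 0\<close>, it follows from \<open>tr A \<ge> 0\<close> because \<open>p < n\<close>; the trace is
  nonnegative because averaging over the whole orthogonal group would otherwise put a negative
  multiple of the identity into \<open>F\<close> (\<open>trace_nonneg_of_riesz_characteristic\<close>).

  Haar measure is avoided: in a closed convex set stable under conjugation by orthogonal matrices,
  the element of least norm is unique and therefore fixed by the conjugations
  (\<open>exists_conj_fixed_point\<close>). Invariance under reflections then determines its shape.
\<close>

section \<open>Quadratic forms and conjugation\<close>

lemma inner_matrix_vector_transpose:
  fixes A :: "real^'n^'m"
  shows "x \<bullet> (A *v y) = (transpose A *v x) \<bullet> y"
  by (simp add: dot_lmul_matrix)

text \<open>By polarization.\<close>

lemma Sym2_eqI_quadratic_form:
  fixes A B :: "real^'n^'n"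
  assumes "A \<in> Sym2" "B \<in> Sym2" and q: "\<And>x. x \<bullet> (A *v x) = x \<bullet> (B *v x)"
  shows "A = B"
proof -
  have sym: "y \<bullet> (C *v x) = x \<bullet> (C *v y)" if C: "C \<in> Sym2" for C :: "real^'n^'n" and x y
  proof -
    have "transpose C = C"
      using C by (simp add: Sym2_def)
    then have "y \<bullet> (C *v x) = (C *v y) \<bullet> x"
      using inner_matrix_vector_transpose[of y C x] by metis
    also have "\<dots> = x \<bullet> (C *v y)"
      by (rule inner_commute)
    finally show ?thesis .
  qed
  have "x \<bullet> (A *v y) = x \<bullet> (B *v y)" for x y
    using q[of "x + y"] q[of x] q[of y] sym[OF assms(1), of x y] sym[OF assms(2), of x y]
    by (simp add: matrix_vector_right_distrib inner_add_left inner_add_right)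
  then have "A *v y = B *v y" for y
    by (subst vector_eq_ldot[symmetric]) blast
  then show ?thesis
    by (simp add: matrix_eq)
qed

lemma inner_matrix_conj:
  fixes g A :: "real^'n^'n"
  shows "x \<bullet> ((g ** A ** transpose g) *v y) = (transpose g *v x) \<bullet> (A *v (transpose g *v y))"
  unfolding matrix_vector_mul_assoc[symmetric] by (rule inner_matrix_vector_transpose)

lemma orthogonal_matrix_inner:
  fixes g :: "real^'n^'n"
  assumes "orthogonal_matrix g"
  shows "(transpose g *v x) \<bullet> (transpose g *v y) = x \<bullet> y"
proof -
  have "(transpose g *v x) \<bullet> (transpose g *v y) = x \<bullet> ((g ** transpose g) *v y)"
    unfolding matrix_vector_mul_assoc[symmetric]
    by (rule inner_matrix_vector_transpose[symmetric])
  then show ?thesis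
    using assms by (simp add: orthogonal_matrix_def)
qed

lemma trace_scaleR: "trace (c *\<^sub>R A) = c * trace (A :: real^'n^'n)"
  by (simp add: trace_def sum_distrib_left)

lemma trace_conj_orthogonal:
  fixes g A :: "real^'n^'n"
  assumes "orthogonal_matrix g"
  shows "trace (g ** A ** transpose g) = trace A"
proof -
  have "trace (g ** A ** transpose g) = trace (transpose g ** g ** A)"
    by (simp only: trace_mul_sym[of "g ** A"] matrix_mul_assoc)
  then show ?thesis
    using assms by (simp add: orthogonal_matrix_def)
qed

lemma trace_eq_sum_quadratic_form:
  fixes A :: "real^'n^'n"
  shows "trace A = (\<Sum>i\<in>UNIV. axis i 1 \<bullet> (A *v axis i 1))"
  by (simp add: trace_def matrix_vector_mult_basis inner_axis' column_def)

lemma inner_matrix_eq_trace: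
  fixes A B :: "real^'n^'n"
  shows "A \<bullet> B = trace (A ** transpose B)"
  by (simp add: inner_vec_def trace_def matrix_matrix_mult_def transpose_def)

text \<open>The Euclidean norm on matrices is the Frobenius norm, hence a trace.\<close>

lemma norm_conj_orthogonal:
  fixes g A :: "real^'n^'n"
  assumes "orthogonal_matrix g"
  shows "norm (g ** A ** transpose g) = norm A"
proof -
  have "(g ** A ** transpose g) ** transpose (g ** A ** transpose g)
      = g ** A ** (transpose g ** g) ** transpose A ** transpose g"
    by (simp only: matrix_transpose_mul transpose_transpose matrix_mul_assoc)
  also have "\<dots> = g ** (A ** transpose A) ** transpose g"
    using assms by (simp only: orthogonal_matrix_def matrix_mul_rid matrix_mul_assoc)
  finally have "(g ** A ** transpose g) \<bullet> (g ** A ** transpose g) = A \<bullet> A"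
    using assms by (simp add: inner_matrix_eq_trace trace_conj_orthogonal)
  then show ?thesis
    by (simp add: norm_eq_sqrt_inner)
qed

lemma matrix_vector_mult_uminus: "(- A) *v x = - (A *v x)" for A :: "real^'n^'m"
  using scaleR_matrix_vector_assoc[of "-1" A x] by simp

lemma Sym2_add: "A \<in> Sym2 \<Longrightarrow> B \<in> Sym2 \<Longrightarrow> A + B \<in> Sym2"
  and Sym2_scaleR: "A \<in> Sym2 \<Longrightarrow> c *\<^sub>R A \<in> Sym2"
  and Sym2_mat: "mat c \<in> Sym2"
  by (simp_all add: Sym2_def transpose_def vec_eq_iff mat_def)

lemma Sym2_conj: "A \<in> Sym2 \<Longrightarrow> g ** A ** transpose g \<in> Sym2"
  by (simp add: Sym2_def matrix_transpose_mul matrix_mul_assoc)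

lemma Sym2_line_proj: "line_proj e \<in> (Sym2 :: (real^'n^'n) set)"
proof -
  have "transpose (line_proj e) *v x = line_proj e *v x" for x :: "real^'n"
  proof -
    have "(transpose (line_proj e) *v x) \<bullet> y = (line_proj e *v x) \<bullet> y" for y
      using inner_matrix_vector_transpose[of y "transpose (line_proj e)" x]
      by (simp add: line_proj_mult_vec inner_commute del: transpose_matrix_vector)
    then show ?thesis
      by (metis vector_eq_rdot)
  qed
  then show ?thesis
    by (simp add: Sym2_def matrix_eq)
qed

lemma trace_line_proj: "trace (line_proj e :: real^'n^'n) = e \<bullet> e"
  by (simp add: trace_eq_sum_quadratic_form line_proj_mult_vec inner_axis inner_axis'
      inner_vec_def[of e e])

lemma closed_Sym2: "closed (Sym2 :: (real^'n^'n) set)"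
proof -
  have "closed (\<Inter>i. \<Inter>j. {A :: real^'n^'n. A $ i $ j = A $ j $ i})"
    by (intro closed_INT ballI closed_Collect_eq continuous_intros)
  moreover have "(\<Inter>i. \<Inter>j. {A :: real^'n^'n. A $ i $ j = A $ j $ i}) = Sym2"
    by (auto simp: Sym2_def vec_eq_iff transpose_def)
  ultimately show ?thesis
    by simp
qed

lemma continuous_quadratic_form:
  fixes x :: "real^'n"
  shows "continuous_on UNIV (\<lambda>A :: real^'n^'n. x \<bullet> (A *v x))"
  unfolding matrix_vector_mult_def inner_vec_def by (simp, intro continuous_intros)

lemma continuous_trace: "continuous_on UNIV (trace :: real^'n^'n \<Rightarrow> real)"
  unfolding trace_def by (intro continuous_intros)

section \<open>The subequations of the trace family\<close>

lemma mem_PSD_delta_iff: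
  fixes A :: "real^'n^'n"
  shows "A \<in> PSD_delta \<delta> \<longleftrightarrow>
    A \<in> Sym2 \<and> (\<forall>x. 0 \<le> x \<bullet> (A *v x) + \<delta> / real CARD('n) * trace A * (x \<bullet> x))"
proof -
  have "x \<bullet> ((A + c *\<^sub>R mat 1) *v x) = x \<bullet> (A *v x) + c * (x \<bullet> x)" for x c
    by (simp add: matrix_vector_mult_add_rdistrib inner_add_right flip: scaleR_matrix_vector_assoc)
  then show ?thesis
    by (auto simp: PSD_delta_def pos_semidef_def Sym2_add Sym2_scaleR Sym2_mat)
qed

lemma mem_PSD_iff: "A \<in> PSD \<longleftrightarrow> A \<in> Sym2 \<and> (\<forall>x. 0 \<le> x \<bullet> (A *v x))"
  by (simp add: PSD_def pos_semidef_def)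

lemma PSD_delta_add:
  fixes A B :: "real^'n^'n"
  assumes "A \<in> PSD_delta \<delta>" "B \<in> PSD_delta \<delta>"
  shows "A + B \<in> PSD_delta \<delta>"
  unfolding mem_PSD_delta_iff
proof (intro conjI allI)
  fix x
  have "0 \<le> (x \<bullet> (A *v x) + \<delta> / real CARD('n) * trace A * (x \<bullet> x))
      + (x \<bullet> (B *v x) + \<delta> / real CARD('n) * trace B * (x \<bullet> x))"
    using assms by (simp add: mem_PSD_delta_iff)
  then show "0 \<le> x \<bullet> ((A + B) *v x) + \<delta> / real CARD('n) * trace (A + B) * (x \<bullet> x)"
    by (simp add: matrix_vector_mult_add_rdistrib trace_add algebra_simps add_divide_distrib)
qed (use assms in \<open>simp add: mem_PSD_delta_iff Sym2_add\<close>)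

lemma cone_PSD_delta: "cone (PSD_delta \<delta> :: (real^'n^'n) set)"
  unfolding cone_def
proof (intro ballI allI impI)
  fix A :: "real^'n^'n" and t :: real
  assume A: "A \<in> PSD_delta \<delta>" and t: "0 \<le> t"
  have "x \<bullet> ((t *\<^sub>R A) *v x) + \<delta> / real CARD('n) * trace (t *\<^sub>R A) * (x \<bullet> x)
      = t * (x \<bullet> (A *v x) + \<delta> / real CARD('n) * trace A * (x \<bullet> x))" for x
    by (simp add: trace_scaleR algebra_simps flip: scaleR_matrix_vector_assoc)
  then show "t *\<^sub>R A \<in> PSD_delta \<delta>"
    using A t by (simp add: mem_PSD_delta_iff Sym2_scaleR)
qed

text \<open>A positive semidefinite matrix has nonnegative trace, so the extra term only helps.\<close>

lemma PSD_subset_PSD_delta: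
  assumes "0 \<le> \<delta>"
  shows "PSD \<subseteq> (PSD_delta \<delta> :: (real^'n^'n) set)"
proof
  fix A :: "real^'n^'n"
  assume A: "A \<in> PSD"
  then have "0 \<le> trace A"
    by (auto simp: trace_eq_sum_quadratic_form mem_PSD_iff intro: sum_nonneg)
  then show "A \<in> PSD_delta \<delta>"
    using A assms by (auto simp: mem_PSD_iff mem_PSD_delta_iff)
qed

lemma closed_PSD_delta: "closed (PSD_delta \<delta> :: (real^'n^'n) set)"
proof -
  have "PSD_delta \<delta> = Sym2 \<inter>
      (\<Inter>x. {A :: real^'n^'n. 0 \<le> x \<bullet> (A *v x) + \<delta> / real CARD('n) * trace A * (x \<bullet> x)})"
    by (auto simp: mem_PSD_delta_iff)
  moreover have "closed {A :: real^'n^'n.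
      0 \<le> x \<bullet> (A *v x) + \<delta> / real CARD('n) * trace A * (x \<bullet> x)}" for x
    by (intro closed_Collect_le continuous_intros continuous_quadratic_form continuous_trace)
  ultimately show ?thesis
    by (simp add: closed_INT closed_Int closed_Sym2)
qed

lemma subequation_PSD_delta:
  assumes "0 \<le> \<delta>"
  shows "subequation (PSD_delta \<delta> :: (real^'n^'n) set)"
proof -
  have zero: "(0 :: real^'n^'n) \<in> PSD_delta \<delta>"
    using PSD_subset_PSD_delta[OF assms] by (auto simp: mem_PSD_iff Sym2_def transpose_def vec_eq_iff)
  have neg: "- mat 1 \<notin> (PSD_delta \<delta> :: (real^'n^'n) set)"
  proof
    define u :: "real^'n" where "u = axis undefined 1"
    have u: "u \<bullet> u = 1"
      by (simp add: u_def inner_axis_axis)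
    have "trace (- mat 1 :: real^'n^'n) = - real CARD('n)"
      using trace_scaleR[of "-1" "mat 1 :: real^'n^'n"] by (simp add: trace_I)
    moreover assume "- mat 1 \<in> (PSD_delta \<delta> :: (real^'n^'n) set)"
    then have "0 \<le> u \<bullet> (- mat 1 *v u) + \<delta> / real CARD('n) * trace (- mat 1 :: real^'n^'n) * (u \<bullet> u)"
      unfolding mem_PSD_delta_iff by blast
    ultimately show False
      using u assms by (simp add: matrix_vector_mult_uminus)
  qed
  have sym: "- mat 1 \<in> (Sym2 :: (real^'n^'n) set)"
    using Sym2_scaleR[OF Sym2_mat, of "-1" "1 :: real"] by simp
  have "PSD_delta \<delta> + PSD \<subseteq> (PSD_delta \<delta> :: (real^'n^'n) set)"
    using PSD_delta_add PSD_subset_PSD_delta[OF assms] by (fastforce elim!: set_plus_elim)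
  moreover have "PSD_delta \<delta> \<subseteq> (Sym2 :: (real^'n^'n) set)"
    by (auto simp: mem_PSD_delta_iff)
  ultimately show ?thesis
    unfolding subequation_def using closed_PSD_delta zero neg sym by blast
qed

lemma orthogonally_invariant_PSD_delta:
  "orthogonally_invariant (PSD_delta \<delta> :: (real^'n^'n) set)"
  unfolding orthogonally_invariant_def
proof (intro allI impI)
  fix g A :: "real^'n^'n"
  assume g: "orthogonal_matrix g" and A: "A \<in> PSD_delta \<delta>"
  have "0 \<le> (transpose g *v x) \<bullet> (A *v (transpose g *v x))
      + \<delta> / real CARD('n) * trace A * ((transpose g *v x) \<bullet> (transpose g *v x))" for x
    using A unfolding mem_PSD_delta_iff by blast
  then show "g ** A ** transpose g \<in> PSD_delta \<delta>"
    using A unfolding mem_PSD_delta_iff inner_matrix_conj trace_conj_orthogonal[OF g]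
      orthogonal_matrix_inner[OF g] by (blast intro: Sym2_conj)
qed

section \<open>Averaging by minimal norm\<close>

text \<open>
  This replaces averaging over a compact group. Conjugation by an orthogonal matrix is an isometry,
  so it maps the point of \<open>K\<close> nearest to the origin to another nearest point, and in a closed convex
  set there is only one.
\<close>

lemma exists_conj_fixed_point:
  fixes K H :: "(real^'n^'n) set"
  assumes K: "closed K" "convex K" "K \<noteq> {}"
    and orth: "\<And>h. h \<in> H \<Longrightarrow> orthogonal_matrix h"
    and inv: "\<And>h M. h \<in> H \<Longrightarrow> M \<in> K \<Longrightarrow> h ** M ** transpose h \<in> K"
  shows "\<exists>B\<in>K. \<forall>h\<in>H. h ** B ** transpose h = B"
proof -
  obtain B where B: "B \<in> K" "\<And>M. M \<in> K \<Longrightarrow> dist 0 B \<le> dist 0 M"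
    using distance_attains_inf[OF K(1,3)] by blast
  have "h ** B ** transpose h = B" if h: "h \<in> H" for h
  proof (rule any_closest_point_unique[OF K(2,1), of _ _ 0])
    show "\<forall>z\<in>K. dist 0 (h ** B ** transpose h) \<le> dist 0 z"
      using B by (simp add: norm_conj_orthogonal[OF orth[OF h]])
  qed (use B inv[OF h] in auto)
  then show ?thesis
    using B(1) by blast
qed

text \<open>For \<open>v = 0\<close> the convention \<open>2 / 0 = 0\<close> makes this the identity.\<close>

definition reflection :: "real^'n \<Rightarrow> real^'n^'n"
  where "reflection v = mat 1 - (2 / (v \<bullet> v)) *\<^sub>R line_proj v"

lemma reflection_mult_vec: "reflection v *v x = x - (2 * (v \<bullet> x) / (v \<bullet> v)) *\<^sub>R v"
  by (simp add: reflection_def matrix_vector_mult_diff_rdistrib line_proj_mult_vec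
      flip: scaleR_matrix_vector_assoc)

lemma transpose_reflection: "transpose (reflection v) = reflection v"
  using Sym2_add[OF Sym2_mat[of 1] Sym2_scaleR[OF Sym2_line_proj], of "- (2 / (v \<bullet> v))" v]
  by (simp add: Sym2_def reflection_def)

lemma orthogonal_reflection: "orthogonal_matrix (reflection v)"
proof -
  have "reflection v ** reflection v = mat 1"
    unfolding matrix_eq
    by (simp add: reflection_mult_vec inner_diff_right flip: matrix_vector_mul_assoc)
  then show ?thesis
    by (simp add: orthogonal_matrix_def transpose_reflection)
qed

lemma reflection_swap:
  assumes "norm v = norm w"
  shows "reflection (v - w) *v v = w"
proof (cases "v = w")
  case False
  have "v \<bullet> v = w \<bullet> w"
    by (metis assms power2_norm_eq_inner)
  then have "2 * ((v - w) \<bullet> v) = (v - w) \<bullet> (v - w)"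
    by (simp add: inner_diff_left inner_diff_right inner_commute[of w v])
  then show ?thesis
    unfolding reflection_mult_vec using False by simp
qed (simp add: reflection_mult_vec)

text \<open>
  Two vectors of \<open>S\<close> of equal length are exchanged by the reflection along their difference, which
  again lies in \<open>S\<close>. So the quadratic form is constant on the unit sphere of \<open>S\<close>.
\<close>

lemma quadratic_form_scalar_on_subspace:
  fixes B :: "real^'n^'n"
  assumes S: "subspace S"
    and fixed: "\<And>v. v \<in> S \<Longrightarrow> reflection v ** B ** transpose (reflection v) = B"
  shows "\<exists>m. \<forall>w\<in>S. w \<bullet> (B *v w) = m * (w \<bullet> w)"
proof (cases "S \<subseteq> {0}")
  case True
  then have "\<forall>w\<in>S. w \<bullet> (B *v w) = 0 * (w \<bullet> w)"
    by auto
  then show ?thesis by blast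
next
  case False
  then obtain u where u: "u \<in> S" "u \<noteq> 0" by blast
  have "w \<bullet> (B *v w) = ((u \<bullet> (B *v u)) / (u \<bullet> u)) * (w \<bullet> w)" if w: "w \<in> S" for w
  proof -
    define u' where "u' = (norm w / norm u) *\<^sub>R u"
    have "w - u' \<in> S" "norm w = norm u'"
      using u w S by (simp_all add: u'_def subspace_diff subspace_scale)
    then have "w \<bullet> (B *v w) = u' \<bullet> (B *v u')"
      using inner_matrix_conj[of w "reflection (w - u')" B w] fixed[of "w - u'"]
      by (simp add: transpose_reflection reflection_swap)
    also have "\<dots> = (norm w / norm u)\<^sup>2 * (u \<bullet> (B *v u))"
      by (simp add: u'_def matrix_vector_mult_scaleR power2_eq_square)
    finally show ?thesis
      by (simp add: power_divide power2_norm_eq_inner)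
  qed
  then show ?thesis by blast
qed

text \<open>
  The quadratic form splits along \<open>e\<close> and its complement: reflection along \<open>v\<close> orthogonal to \<open>e\<close>
  fixes \<open>e\<close> and negates \<open>v\<close>, which kills the mixed terms, and on the complement the form is a
  multiple of the squared length.
\<close>

lemma axially_symmetric_form:
  fixes B :: "real^'n^'n"
  assumes B: "B \<in> Sym2" and e: "norm e = 1"
    and fixed: "\<And>v. e \<bullet> v = 0 \<Longrightarrow> reflection v ** B ** transpose (reflection v) = B"
  shows "\<exists>m. B = (e \<bullet> (B *v e)) *\<^sub>R line_proj e + m *\<^sub>R perp_proj e"
proof -
  have ee: "e \<bullet> e = 1"
    using e by (simp add: norm_eq_1)
  have inv: "x \<bullet> (B *v y) = (reflection v *v x) \<bullet> (B *v (reflection v *v y))"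
    if "e \<bullet> v = 0" for v x y
    using inner_matrix_conj[of x "reflection v" B y] fixed[OF that]
    by (simp add: transpose_reflection)
  have cross: "e \<bullet> (B *v v) = 0" "v \<bullet> (B *v e) = 0" if v: "e \<bullet> v = 0" for v
  proof -
    have "reflection v *v e = e" "reflection v *v v = - v"
      using v by (cases "v = 0"; simp add: reflection_mult_vec inner_commute scaleR_2)+
    then show "e \<bullet> (B *v v) = 0"
      using inv[OF v, of e v] matrix_vector_mult_diff_distrib[of B 0 v] by simp
    then show "v \<bullet> (B *v e) = 0"
      using B inner_matrix_vector_transpose[of v B e] by (simp add: Sym2_def inner_commute)
  qed
  have "subspace {v. e \<bullet> v = 0}"
    by (simp add: subspace_def inner_add_right)
  then obtain m where m: "w \<bullet> (B *v w) = m * (w \<bullet> w)" if "e \<bullet> w = 0" for w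
    using quadratic_form_scalar_on_subspace[of "{v. e \<bullet> v = 0}" B] fixed by auto
  have "B = (e \<bullet> (B *v e)) *\<^sub>R line_proj e + m *\<^sub>R perp_proj e"
  proof (rule Sym2_eqI_quadratic_form[OF B])
    have "perp_proj e = mat 1 + (-1) *\<^sub>R line_proj e"
      by (simp add: perp_proj_def)
    then show "(e \<bullet> (B *v e)) *\<^sub>R line_proj e + m *\<^sub>R perp_proj e \<in> Sym2"
      by (metis Sym2_add Sym2_scaleR Sym2_line_proj Sym2_mat)
  next
    fix x
    define s where "s = e \<bullet> x"
    define w where "w = x - s *\<^sub>R e"
    have x: "x = s *\<^sub>R e + w" and w: "e \<bullet> w = 0"
      by (simp_all add: w_def s_def inner_diff_right ee)
    have "x \<bullet> (B *v x) = s\<^sup>2 * (e \<bullet> (B *v e)) + m * (w \<bullet> w)"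
      using m[OF w] cross[OF w] unfolding x
      by (simp add: matrix_vector_right_distrib matrix_vector_mult_scaleR inner_add_left
          inner_add_right power2_eq_square)
    also have "w \<bullet> w = x \<bullet> x - s\<^sup>2"
      by (simp add: w_def s_def inner_diff_left inner_diff_right inner_commute[of x e] ee
          power2_eq_square)
    finally show "x \<bullet> (B *v x)
        = x \<bullet> (((e \<bullet> (B *v e)) *\<^sub>R line_proj e + m *\<^sub>R perp_proj e) *v x)"
      by (simp add: perp_proj_def matrix_vector_mult_add_rdistrib matrix_vector_mult_diff_rdistrib
          line_proj_mult_vec inner_add_right inner_diff_right s_def inner_commute power2_eq_square
          algebra_simps flip: scaleR_matrix_vector_assoc)
  qed
  then show ?thesis by blast
qed

text \<open>
  The slice \<open>K\<close> of \<open>F\<close> on which the value at \<open>e\<close> and the trace agree with those of \<open>A\<close> is closed,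
  convex and stable under the reflections that fix \<open>e\<close>, so it contains a fixed point of them.
\<close>

lemma exists_axially_symmetric_mem:
  fixes F :: "(real^'n^'n) set"
  assumes F: "closed F" "convex F" "F \<subseteq> Sym2" "orthogonally_invariant F"
    and A: "A \<in> F" and e: "norm e = 1"
  shows "\<exists>m. (e \<bullet> (A *v e)) *\<^sub>R line_proj e + m *\<^sub>R perp_proj e \<in> F
    \<and> trace A = e \<bullet> (A *v e) + m * (real CARD('n) - 1)"
proof -
  define K where "K = F \<inter> {M. e \<bullet> (M *v e) = e \<bullet> (A *v e)} \<inter> {M. trace M = trace A}"
  have "closed K"
    unfolding K_def
    by (intro closed_Int F closed_Collect_eq continuous_quadratic_form continuous_trace
        continuous_on_const)
  moreover have "convex K"
  proof -
    have "linear (\<lambda>M :: real^'n^'n. e \<bullet> (M *v e))" "linear (trace :: real^'n^'n \<Rightarrow> real)"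
      by (simp_all add: linear_iff matrix_vector_mult_add_rdistrib inner_add_right trace_add
          trace_scaleR flip: scaleR_matrix_vector_assoc)
    then have "convex ((\<lambda>M :: real^'n^'n. e \<bullet> (M *v e)) -` {e \<bullet> (A *v e)})"
        "convex ((trace :: real^'n^'n \<Rightarrow> real) -` {trace A})"
      by (intro convex_linear_vimage convex_singleton; simp)+
    then show ?thesis
      unfolding K_def using F by (intro convex_Int) (auto simp: vimage_def)
  qed
  moreover have "K \<noteq> {}"
    using A by (auto simp: K_def)
  moreover have "reflection v ** M ** transpose (reflection v) \<in> K"
    if v: "e \<bullet> v = 0" and M: "M \<in> K" for v M
  proof -
    have "reflection v *v e = e"
      using v by (simp add: reflection_mult_vec inner_commute)
    then have "e \<bullet> ((reflection v ** M ** transpose (reflection v)) *v e) = e \<bullet> (M *v e)"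
      using inner_matrix_conj[of e "reflection v" M e] by (simp add: transpose_reflection)
    moreover have "reflection v ** M ** transpose (reflection v) \<in> F"
      using M F(4) orthogonal_reflection[of v] unfolding K_def orthogonally_invariant_def by blast
    ultimately show ?thesis
      using M trace_conj_orthogonal[OF orthogonal_reflection[of v], of M] by (simp add: K_def)
  qed
  ultimately obtain B where B: "B \<in> K"
    and fixed: "\<And>v. e \<bullet> v = 0 \<Longrightarrow> reflection v ** B ** transpose (reflection v) = B"
    using exists_conj_fixed_point[of K "reflection ` {v. e \<bullet> v = 0}"] orthogonal_reflection
    by auto
  then have "B \<in> Sym2" "e \<bullet> (B *v e) = e \<bullet> (A *v e)" "trace B = trace A" "B \<in> F"
    using F(3) by (auto simp: K_def)
  moreover obtain m where "B = (e \<bullet> (B *v e)) *\<^sub>R line_proj e + m *\<^sub>R perp_proj e"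
    using axially_symmetric_form[OF \<open>B \<in> Sym2\<close> e fixed] by blast
  moreover have "trace (l *\<^sub>R line_proj e + m *\<^sub>R perp_proj e) = l + m * (real CARD('n) - 1)" for l
    using e by (simp add: perp_proj_def trace_add trace_sub trace_scaleR trace_line_proj trace_I
        norm_eq_1)
  ultimately show ?thesis
    by metis
qed

section \<open>Consequences of the Riesz characteristic\<close>

lemma le_riesz_characteristic:
  assumes "norm e = 1" "perp_proj e - (q - 1) *\<^sub>R line_proj e \<in> F"
  shows "ereal q \<le> riesz_characteristic F"
  unfolding riesz_characteristic_def using assms by (intro Sup_upper) blast

lemma convex_trace_level: "convex {M :: real^'n^'n. trace M = t}"
  by (auto simp: convex_def trace_add trace_scaleR simp flip: distrib_right)

text \<open>
  The same argument with only the trace prescribed and the full orthogonal group acting: the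
  average of \<open>A\<close> over the group is the multiple of the identity with the trace of \<open>A\<close>.
\<close>

lemma scalar_matrix_mem_of_mem:
  fixes F :: "(real^'n^'n) set"
  assumes F: "closed F" "convex F" "F \<subseteq> Sym2" "orthogonally_invariant F" and A: "A \<in> F"
  shows "(trace A / real CARD('n)) *\<^sub>R mat 1 \<in> F"
proof -
  define K where "K = F \<inter> {M. trace M = trace A}"
  have "closed K" "convex K"
    unfolding K_def
    by (intro closed_Int convex_Int F convex_trace_level closed_Collect_eq continuous_trace
        continuous_on_const)+
  moreover have "K \<noteq> {}"
    using A by (auto simp: K_def)
  moreover have "h ** M ** transpose h \<in> K" if "orthogonal_matrix h" "M \<in> K" for h M
    using F(4) that by (auto simp: K_def orthogonally_invariant_def trace_conj_orthogonal)
  ultimately obtain B where B: "B \<in> K"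
    and fixed: "\<And>h. orthogonal_matrix h \<Longrightarrow> h ** B ** transpose h = B"
    using exists_conj_fixed_point[of K "Collect orthogonal_matrix"] by auto
  obtain m where m: "w \<bullet> (B *v w) = m * (w \<bullet> w)" for w
    using quadratic_form_scalar_on_subspace[of UNIV B] fixed orthogonal_reflection by auto
  have "B \<in> Sym2"
    using B F(3) by (auto simp: K_def)
  then have "B = m *\<^sub>R mat 1"
    by (rule Sym2_eqI_quadratic_form)
      (simp_all add: m Sym2_scaleR Sym2_mat flip: scaleR_matrix_vector_assoc)
  moreover have "trace B = trace A" "B \<in> F"
    using B by (auto simp: K_def)
  moreover from calculation have "m * real CARD('n) = trace A"
    by (auto simp: trace_scaleR trace_I)
  then have "m = trace A / real CARD('n)"
    by (simp add: eq_divide_eq)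
  ultimately show ?thesis
    by simp
qed

text \<open>
  If the trace were negative, every \<open>- q I\<close> with \<open>q \<ge> 0\<close> would be in the cone. Adding the positive
  matrix \<open>I + q P_e\<^sup>\<bottom>\<close> gives \<open>P_e\<^sup>\<bottom> - (q - 1) P_e\<close>, and the Riesz characteristic would be infinite.
\<close>

lemma trace_nonneg_of_riesz_characteristic:
  fixes F :: "(real^'n^'n) set"
  assumes F: "subequation F" "cone F" "convex F" "orthogonally_invariant F"
    and p: "riesz_characteristic F = ereal p" and A: "A \<in> F"
  shows "0 \<le> trace A"
proof (rule ccontr)
  assume "\<not> 0 \<le> trace A"
  then have neg: "trace A / real CARD('n) < 0"
    by (simp add: divide_neg_pos)
  define e :: "real^'n" where "e = axis undefined 1"
  have e: "norm e = 1"
    by (simp add: e_def)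
  \<comment> \<open>Any positive number above \<open>p\<close> would do.\<close>
  define q where "q = \<bar>p\<bar> + 1"
  have "(trace A / real CARD('n)) *\<^sub>R mat 1 \<in> F"
    using scalar_matrix_mem_of_mem F A unfolding subequation_def by blast
  moreover have "0 \<le> q / (- (trace A / real CARD('n)))"
    using neg unfolding q_def by (intro divide_nonneg_pos) auto
  ultimately have "(q / (- (trace A / real CARD('n)))) *\<^sub>R (trace A / real CARD('n)) *\<^sub>R mat 1 \<in> F"
    using F(2) unfolding cone_def by blast
  then have "(- q) *\<^sub>R mat 1 \<in> F"
    using neg by (simp add: divide_simps split: if_splits)
  moreover have "mat 1 + q *\<^sub>R perp_proj e \<in> PSD"
    unfolding mem_PSD_iff
  proof (intro conjI allI)
    have "mat 1 + q *\<^sub>R perp_proj e = mat 1 + q *\<^sub>R mat 1 + (- q) *\<^sub>R line_proj e"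
      by (simp add: perp_proj_def algebra_simps)
    then show "mat 1 + q *\<^sub>R perp_proj e \<in> Sym2"
      by (metis Sym2_add Sym2_mat Sym2_scaleR Sym2_line_proj)
    fix x
    have "(e \<bullet> x)\<^sup>2 \<le> x \<bullet> x"
      using Cauchy_Schwarz_ineq[of e x] e by (simp add: norm_eq_1)
    then have "0 \<le> x \<bullet> x + q * (x \<bullet> x - (e \<bullet> x)\<^sup>2)"
      by (simp add: q_def)
    then show "0 \<le> x \<bullet> ((mat 1 + q *\<^sub>R perp_proj e) *v x)"
      by (simp add: perp_proj_def matrix_vector_mult_add_rdistrib matrix_vector_mult_diff_rdistrib
          line_proj_mult_vec inner_add_right inner_diff_right inner_commute power2_eq_square
          flip: scaleR_matrix_vector_assoc)
  qed
  ultimately have "(- q) *\<^sub>R mat 1 + (mat 1 + q *\<^sub>R perp_proj e) \<in> F"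
    using F(1) unfolding subequation_def by (blast intro: set_plus_intro)
  moreover have "(- q) *\<^sub>R mat 1 + (mat 1 + q *\<^sub>R perp_proj e)
      = perp_proj e - (q - 1) *\<^sub>R line_proj e"
    by (simp add: perp_proj_def algebra_simps)
  ultimately have "ereal q \<le> ereal p"
    using le_riesz_characteristic[OF e] p by metis
  then show False
    by (simp add: q_def)
qed

text \<open>By homogeneity the defining inequality needs testing on unit vectors only.\<close>

lemma mem_P_largest_iff:
  fixes A :: "real^'n^'n"
  shows "A \<in> P_largest p \<longleftrightarrow>
    A \<in> Sym2 \<and> (\<forall>e. norm e = 1 \<longrightarrow> 0 \<le> e \<bullet> (A *v e) + (p - 1) / (real CARD('n) - p) * trace A)"
proof -
  define c where "c = (p - 1) / (real CARD('n) - p) * trace A"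
  have "x \<bullet> ((A + c *\<^sub>R mat 1) *v x) = x \<bullet> (A *v x) + c * (x \<bullet> x)" for x
    by (simp add: matrix_vector_mult_add_rdistrib inner_add_right flip: scaleR_matrix_vector_assoc)
  then have *: "A \<in> P_largest p \<longleftrightarrow> A \<in> Sym2 \<and> (\<forall>x. 0 \<le> x \<bullet> (A *v x) + c * (x \<bullet> x))"
    using Sym2_add[OF _ Sym2_scaleR[OF Sym2_mat], of A c 1]
    unfolding P_largest_def pos_semidef_def mem_Collect_eq c_def[symmetric] by metis
  have "0 \<le> x \<bullet> (A *v x) + c * (x \<bullet> x)"
    if h: "\<And>e. norm e = 1 \<Longrightarrow> 0 \<le> e \<bullet> (A *v e) + c" for x
  proof (cases "x = 0")
    case False
    define e where "e = sgn x"
    have x: "x = norm x *\<^sub>R e" and e: "norm e = 1"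
      using False by (simp_all add: e_def sgn_div_norm norm_sgn)
    have "x \<bullet> (A *v x) + c * (x \<bullet> x) = (norm x)\<^sup>2 * (e \<bullet> (A *v e) + c)"
      by (subst (1 2) x, simp add: matrix_vector_mult_scaleR power2_norm_eq_inner[symmetric])
         (simp add: power2_eq_square algebra_simps)
    then show ?thesis
      using h[OF e] by simp
  qed simp
  then show ?thesis
    unfolding * c_def[symmetric] by (metis mult.right_neutral norm_eq_1)
qed

lemma subset_P_largest:
  fixes F :: "(real^'n^'n) set"
  assumes F: "subequation F" "cone F" "convex F" "orthogonally_invariant F"
    and p: "riesz_characteristic F = ereal p" and p1: "1 \<le> p" and pn: "p < real CARD('n)"
  shows "F \<subseteq> P_largest p"
proof
  fix A
  assume A: "A \<in> F"
  have "0 \<le> e \<bullet> (A *v e) + (p - 1) / (real CARD('n) - p) * trace A" if e: "norm e = 1" for e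
  proof -
    define l where "l = e \<bullet> (A *v e)"
    obtain m where m: "l *\<^sub>R line_proj e + m *\<^sub>R perp_proj e \<in> F"
      and tr: "trace A = l + m * (real CARD('n) - 1)"
      using exists_axially_symmetric_mem[OF _ F(3) _ F(4) A e] F(1)
      unfolding subequation_def l_def by blast
    \<comment> \<open>Up to the positive factor \<open>(n - 1) / (n - p)\<close>, this is the inequality to be shown.\<close>
    have "0 \<le> l + (p - 1) * m"
    proof (cases "0 < m")
      case True
      have "(1 / m) *\<^sub>R (l *\<^sub>R line_proj e + m *\<^sub>R perp_proj e) \<in> F"
        using F(2) m True unfolding cone_def by simp
      then have "perp_proj e - ((1 - l / m) - 1) *\<^sub>R line_proj e \<in> F"
        using True by (simp add: scaleR_add_right add.commute)
      then have "1 - l / m \<le> p"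
        using le_riesz_characteristic[OF e] p by (metis ereal_less_eq(3))
      then show ?thesis
        using True by (simp add: field_simps)
    next
      case False
      have "0 \<le> l + m * (real CARD('n) - 1)"
        using trace_nonneg_of_riesz_characteristic[OF F p A] tr by simp
      moreover have "m * (real CARD('n) - 1) \<le> m * (p - 1)"
        using False pn by (intro mult_left_mono_neg) auto
      ultimately show ?thesis
        by (simp add: mult.commute)
    qed
    then have "0 \<le> (real CARD('n) - 1) * (l + (p - 1) * m) / (real CARD('n) - p)"
      using p1 pn by simp
    also have "\<dots> = l + (p - 1) / (real CARD('n) - p) * trace A"
      using pn unfolding tr by (simp add: field_simps)
    finally show ?thesis
      by (simp add: l_def)
  qed
  then show "A \<in> P_largest p"
    using A F(1) unfolding subequation_def mem_P_largest_iff by blast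
qed

section \<open>The largest subequation\<close>

lemma P_largest_eq_PSD_delta:
  "(P_largest p :: (real^'n^'n) set) = PSD_delta ((p - 1) * real CARD('n) / (real CARD('n) - p))"
  by (simp add: P_largest_def PSD_delta_def)

lemma riesz_characteristic_P_largest:
  assumes "CARD('n::finite) \<ge> 2" "1 \<le> p" and pn: "p < real CARD('n)"
  shows "riesz_characteristic (P_largest p :: (real^'n^'n) set) = ereal p"
proof -
  have *: "perp_proj e - (q - 1) *\<^sub>R line_proj e \<in> (P_largest p :: (real^'n^'n) set) \<longleftrightarrow>
      (\<forall>x. norm x = 1 \<longrightarrow> 0 \<le> 1 - q * (e \<bullet> x)\<^sup>2 + (p - 1) / (real CARD('n) - p) * (real CARD('n) - q))"
    if e: "norm e = 1" for e :: "real^'n" and q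
  proof -
    have eq: "perp_proj e - (q - 1) *\<^sub>R line_proj e = mat 1 + (- q) *\<^sub>R line_proj e"
      by (simp add: perp_proj_def algebra_simps)
    have "mat 1 + (- q) *\<^sub>R line_proj e \<in> Sym2"
      by (metis Sym2_add Sym2_mat Sym2_scaleR Sym2_line_proj)
    moreover have "trace (mat 1 + (- q) *\<^sub>R line_proj e) = real CARD('n) - q"
      using e unfolding trace_add trace_scaleR trace_I trace_line_proj by (simp add: norm_eq_1)
    moreover have "x \<bullet> ((mat 1 + (- q) *\<^sub>R line_proj e) *v x) = 1 - q * (e \<bullet> x)\<^sup>2"
      if "norm x = 1" for x
      using that unfolding matrix_vector_mult_add_rdistrib
      by (simp add: line_proj_mult_vec inner_diff_right inner_commute[of x e] norm_eq_1 power2_eq_square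
          matrix_vector_mult_uminus flip: scaleR_matrix_vector_assoc)
    ultimately show ?thesis
      unfolding eq mem_P_largest_iff by simp
  qed
  define e :: "real^'n" where "e = axis undefined 1"
  have e: "norm e = 1"
    by (simp add: e_def)
  have "perp_proj e - (p - 1) *\<^sub>R line_proj e \<in> (P_largest p :: (real^'n^'n) set)"
    unfolding *[OF e]
  proof (intro allI impI)
    fix x :: "real^'n"
    assume x: "norm x = 1"
    have "(e \<bullet> x)\<^sup>2 \<le> 1"
      using Cauchy_Schwarz_ineq[of e x] e x by (simp add: norm_eq_1)
    then have "p * (e \<bullet> x)\<^sup>2 \<le> p * 1"
      using assms by (intro mult_left_mono) auto
    then show "0 \<le> 1 - p * (e \<bullet> x)\<^sup>2 + (p - 1) / (real CARD('n) - p) * (real CARD('n) - p)"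
      using pn by simp
  qed
  then have "ereal p \<le> riesz_characteristic (P_largest p :: (real^'n^'n) set)"
    by (rule le_riesz_characteristic[OF e])
  moreover have "q \<le> p"
    if d: "norm d = 1" and mem: "perp_proj d - (q - 1) *\<^sub>R line_proj d \<in> (P_largest p :: (real^'n^'n) set)"
    for d q
  proof -
    have "d \<bullet> d = 1"
      using d by (simp add: norm_eq_1)
    then have "0 \<le> 1 - q + (p - 1) / (real CARD('n) - p) * (real CARD('n) - q)"
      using mem d unfolding *[OF d] by (metis mult.right_neutral power_one)
    also have "\<dots> = (real CARD('n) - 1) * (p - q) / (real CARD('n) - p)"
      using pn by (simp add: field_simps)
    finally show ?thesis
      using assms by (simp add: zero_le_divide_iff zero_le_mult_iff)
  qed
  then have "riesz_characteristic (P_largest p :: (real^'n^'n) set) \<le> ereal p"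
    unfolding riesz_characteristic_def by (intro Sup_least) auto
  ultimately show ?thesis
    by simp
qed

text \<open>As \<open>PSD_delta \<delta>\<close> is closed under addition, it is elliptic with its own parameter \<open>\<delta>\<close>.\<close>

lemma uniformly_elliptic_PSD_delta:
  assumes "0 < \<delta>"
  shows "uniformly_elliptic (PSD_delta \<delta> :: (real^'n^'n) set)"
  unfolding uniformly_elliptic_def
  using assms subequation_PSD_delta[of \<delta>] PSD_delta_add[of _ \<delta>]
  by (fastforce elim!: set_plus_elim)

theorem proposition13p9:
  fixes p :: real
  assumes "CARD('n::finite) \<ge> 2" and "1 \<le> p" and "p < real CARD('n)"
  shows "subequation (P_largest p :: (real^'n^'n) set)
    \<and> cone (P_largest p :: (real^'n^'n) set)
    \<and> orthogonally_invariant (P_largest p :: (real^'n^'n) set)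
    \<and> (\<forall>F :: (real^'n^'n) set.
        subequation F \<and> cone F \<and> convex F \<and> orthogonally_invariant F
          \<and> riesz_characteristic F = ereal p \<longrightarrow> F \<subseteq> P_largest p)
    \<and> riesz_characteristic (P_largest p :: (real^'n^'n) set) = ereal p
    \<and> (P_largest p :: (real^'n^'n) set) = PSD_delta ((p - 1) * real CARD('n) / (real CARD('n) - p))
    \<and> (p > 1 \<longrightarrow> uniformly_elliptic (P_largest p :: (real^'n^'n) set))"
proof -
  define \<delta> where "\<delta> = (p - 1) * real CARD('n) / (real CARD('n) - p)"
  have "0 \<le> \<delta>" "1 < p \<Longrightarrow> 0 < \<delta>"
    using assms by (simp_all add: \<delta>_def)
  then show ?thesis
    using subset_P_largest[OF _ _ _ _ _ assms(2,3)] riesz_characteristic_P_largest[OF assms]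
    unfolding P_largest_eq_PSD_delta \<delta>_def[symmetric]
    by (auto simp: subequation_PSD_delta cone_PSD_delta orthogonally_invariant_PSD_delta
        uniformly_elliptic_PSD_delta)
qed

end
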